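(* Let $a,b$ be constants. Then in a neighborhood of $x=0$, $$\sum_{n=0}^\infty(an+b)\binom{2n}{n}\frac{x^n}{(1+4x)^{2n}}\sum_{k=0}^n\binom{2k}k^2\binom{2n-2k}{n-k}x^k=\sum_{n=0}^\infty(An+B)\binom{3n}n\binom{2n}n^2x^{2n}(1-4x)^n,$$ where $$A=\frac{4a(1+4x)^2(1-6x)}{3(1-4x)^2},\qquad B=(1+4x)\Bigl(\frac{4ax}{1-4x}+b\Bigr).$$ Moreover, for real $x$ the series on the right-hand side converges for $-1/12<x<1/6$. *)

theory Defs
  imports Complex_Main
begin

definition lhs_term :: "complex \<Rightarrow> complex \<Rightarrow> complex \<Rightarrow> nat \<Rightarrow> complex" where
  "lhs_term a b x n =
     (a * of_nat n + b) * of_nat ((2 * n) choose n) * (x ^ n / (1 + 4 * x) ^ (2 * n)) *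
     (\<Sum>k = 0..n. of_nat ((2 * k) choose k) ^ 2 * of_nat ((2 * n - 2 * k) choose (n - k)) * x ^ k)"

definition A_coeff :: "complex \<Rightarrow> complex \<Rightarrow> complex" where
  "A_coeff a x = 4 * a * (1 + 4 * x) ^ 2 * (1 - 6 * x) / (3 * (1 - 4 * x) ^ 2)"

definition B_coeff :: "complex \<Rightarrow> complex \<Rightarrow> complex \<Rightarrow> complex" where
  "B_coeff a b x = (1 + 4 * x) * (4 * a * x / (1 - 4 * x) + b)"

definition rhs_term :: "complex \<Rightarrow> complex \<Rightarrow> complex \<Rightarrow> nat \<Rightarrow> complex" where
  "rhs_term a b x n =
     (A_coeff a x * of_nat n + B_coeff a b x) *
     of_nat ((3 * n) choose n) * of_nat ((2 * n) choose n) ^ 2 * x ^ (2 * n) * (1 - 4 * x) ^ n"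

end

theory Submission imports Defs "HOL-Complex_Analysis.Complex_Analysis" begin

text \<open>
  Write the left-hand side as a double series over \<open>k\<close> and \<open>m = n - k\<close> and regard both sides as formal
  power series in \<open>x\<close>. For a polynomial weight \<open>P(k, m)\<close> let \<open>[P]\<close> be the series with summand multiplied
  by \<open>P\<close>. Shifting \<open>k\<close> or \<open>m\<close> gives linear relations between the \<open>[P]\<close>, and the Euler derivation maps
  \<open>[P]\<close> to another such series. Creative telescoping shows that
  \<open>S = [(1 - 4x) m - (1 + 12x) k - 4x]\<close> satisfies a second order differential equation with exponents
  \<open>0\<close> and \<open>1/2\<close> at the origin; since its constant term is zero, \<open>S = 0\<close>. Modulo \<open>S\<close>, the series
  \<open>[1] / (1 + 4x)\<close> satisfies the third order equation, with triple exponent \<open>0\<close>, of the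
  hypergeometric series in \<open>x\<^sup>2 (1 - 4x)\<close>, so the two agree. This is the case \<open>a = 0\<close>, and \<open>S = 0\<close> expresses
  \<open>[n]\<close> through \<open>[1]\<close> and its derivative, which is the case \<open>b = 0\<close>.
\<close>

subsection \<open>Locally finite families of formal power series\<close>

definition locally_finite_fps :: "('i \<Rightarrow> 'a::zero fps) \<Rightarrow> bool" where
  "locally_finite_fps f \<longleftrightarrow> (\<forall>N. finite {i. fps_nth (f i) N \<noteq> 0})"

text \<open>Summation is coefficientwise over an arbitrary index type. A coefficient with infinitely
  many nonzero contributions gets the default value 0, so the operator is meaningful only for
  locally finite families.\<close>

definition fps_Sum :: "('i \<Rightarrow> 'a::comm_monoid_add fps) \<Rightarrow> 'a fps" where
  "fps_Sum f = Abs_fps (\<lambda>N. \<Sum>i | fps_nth (f i) N \<noteq> 0. fps_nth (f i) N)"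

lemma fps_Sum_nth:
  assumes "finite A" "{i. fps_nth (f i) N \<noteq> 0} \<subseteq> A"
  shows "fps_nth (fps_Sum f) N = (\<Sum>i\<in>A. fps_nth (f i) N)"
  unfolding fps_Sum_def fps_nth_Abs_fps
  by (rule sum.mono_neutral_left) (use assms in auto)

text \<open>Coefficient \<open>N\<close> of a product mixes all coefficients up to \<open>N\<close>
  of a factor. This supplies one finite index set that serves all of these degrees at once.\<close>

lemma locally_finite_fps_upto:
  assumes "locally_finite_fps f"
  shows "finite {i. \<exists>j\<le>N. fps_nth (f i) j \<noteq> 0}"
proof -
  have "{i. \<exists>j\<le>N. fps_nth (f i) j \<noteq> 0} = (\<Union>j\<le>N. {i. fps_nth (f i) j \<noteq> 0})"
    by auto
  then show ?thesis
    using assms by (simp add: locally_finite_fps_def)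
qed

text \<open>A product can be nonzero in degree \<open>N\<close> only if \<open>f i\<close> is
  nonzero in some degree up to \<open>N\<close>. The multiplier may therefore depend on
  \<open>i\<close> freely, which is what admits arbitrary weights on the summands later on.\<close>

lemma locally_finite_fps_mult:
  fixes f g :: "'i \<Rightarrow> 'a::comm_ring_1 fps"
  assumes "locally_finite_fps f"
  shows "locally_finite_fps (\<lambda>i. g i * f i)"
  unfolding locally_finite_fps_def
proof
  fix N
  have "{i. fps_nth (g i * f i) N \<noteq> 0} \<subseteq> {i. \<exists>j\<le>N. fps_nth (f i) j \<noteq> 0}"
  proof clarify
    fix i assume "fps_nth (g i * f i) N \<noteq> 0"
    then obtain j where "j \<in> {0..N}" "fps_nth (g i) j * fps_nth (f i) (N - j) \<noteq> 0"
      unfolding fps_mult_nth by (meson sum.neutral)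
    then show "\<exists>j\<le>N. fps_nth (f i) j \<noteq> 0"
      by (intro exI[of _ "N - j"]) auto
  qed
  then show "finite {i. fps_nth (g i * f i) N \<noteq> 0}"
    using locally_finite_fps_upto[OF assms] finite_subset by blast
qed

lemma fps_Sum_add:
  assumes "locally_finite_fps f" "locally_finite_fps g"
  shows "fps_Sum (\<lambda>i. f i + g i) = fps_Sum f + fps_Sum g"
proof (rule fps_ext)
  fix N
  let ?A = "{i. fps_nth (f i) N \<noteq> 0} \<union> {i. fps_nth (g i) N \<noteq> 0}"
  have "finite ?A"
    using assms by (auto simp: locally_finite_fps_def)
  moreover have "{i. fps_nth (f i + g i) N \<noteq> 0} \<subseteq> ?A" by auto
  ultimately show "fps_nth (fps_Sum (\<lambda>i. f i + g i)) N = fps_nth (fps_Sum f + fps_Sum g) N"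
    by (simp add: fps_Sum_nth[of ?A] sum.distrib)
qed

lemma fps_Sum_cmult:
  fixes f :: "'i \<Rightarrow> 'a::comm_ring_1 fps"
  assumes "locally_finite_fps f"
  shows "fps_Sum (\<lambda>i. c * f i) = c * fps_Sum f"
proof (rule fps_ext)
  fix N
  let ?A = "{i. \<exists>j\<le>N. fps_nth (f i) j \<noteq> 0}"
  have fin: "finite ?A"
    by (rule locally_finite_fps_upto[OF assms])
  have "{i. fps_nth (c * f i) N \<noteq> 0} \<subseteq> ?A"
  proof clarify
    fix i assume "fps_nth (c * f i) N \<noteq> 0"
    then obtain j where "j \<in> {0..N}" "fps_nth c j * fps_nth (f i) (N - j) \<noteq> 0"
      unfolding fps_mult_nth by (meson sum.neutral)
    then show "\<exists>j\<le>N. fps_nth (f i) j \<noteq> 0"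
      by (intro exI[of _ "N - j"]) auto
  qed
  then have "fps_nth (fps_Sum (\<lambda>i. c * f i)) N = (\<Sum>i\<in>?A. \<Sum>j=0..N. fps_nth c j * fps_nth (f i) (N - j))"
    using fin by (subst fps_Sum_nth[of ?A]) (auto simp: fps_mult_nth)
  also have "\<dots> = (\<Sum>j=0..N. fps_nth c j * (\<Sum>i\<in>?A. fps_nth (f i) (N - j)))"
    by (subst sum.swap) (simp add: sum_distrib_left)
  also have "\<dots> = (\<Sum>j=0..N. fps_nth c j * fps_nth (fps_Sum f) (N - j))"
    by (intro sum.cong refl arg_cong2[where f = "(*)"] fps_Sum_nth[symmetric] fin)
       (use diff_le_self in blast)
  finally show "fps_nth (fps_Sum (\<lambda>i. c * f i)) N = fps_nth (c * fps_Sum f) N"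
    by (simp add: fps_mult_nth)
qed

lemma fps_deriv_fps_Sum:
  fixes f :: "'i \<Rightarrow> 'a::comm_ring_1 fps"
  assumes "locally_finite_fps f"
  shows "fps_deriv (fps_Sum f) = fps_Sum (\<lambda>i. fps_deriv (f i))"
proof (rule fps_ext)
  fix N
  let ?A = "{i. fps_nth (f i) (N + 1) \<noteq> 0}"
  have "finite ?A"
    using assms by (auto simp: locally_finite_fps_def)
  then show "fps_nth (fps_deriv (fps_Sum f)) N = fps_nth (fps_Sum (\<lambda>i. fps_deriv (f i))) N"
    by (subst fps_Sum_nth[of ?A]) (auto simp: fps_Sum_nth[of ?A] sum_distrib_left)
qed

lemma locally_finite_fps_deriv:
  assumes "locally_finite_fps f"
  shows "locally_finite_fps (\<lambda>i. fps_deriv (f i))"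
  unfolding locally_finite_fps_def
proof
  fix N
  have "{i. fps_nth (fps_deriv (f i)) N \<noteq> 0} \<subseteq> {i. fps_nth (f i) (N + 1) \<noteq> 0}"
    by auto
  then show "finite {i. fps_nth (fps_deriv (f i)) N \<noteq> 0}"
    using assms finite_subset unfolding locally_finite_fps_def by blast
qed

text \<open>This is the source of all telescoping below: \<open>h\<close> will be an index shift,
  and the boundary terms outside its range vanish.\<close>

lemma fps_Sum_reindex:
  assumes "locally_finite_fps f" "inj h" "\<And>i. i \<notin> range h \<Longrightarrow> f i = 0"
  shows "fps_Sum (\<lambda>i. f (h i)) = fps_Sum f"
proof (rule fps_ext)
  fix N
  have eq: "{i. fps_nth (f i) N \<noteq> 0} = h ` {i. fps_nth (f (h i)) N \<noteq> 0}"
    using assms(3) by (auto simp: image_iff) (metis fps_zero_nth rangeE)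
  show "fps_nth (fps_Sum (\<lambda>i. f (h i))) N = fps_nth (fps_Sum f) N"
    unfolding fps_Sum_def fps_nth_Abs_fps eq
    by (subst sum.reindex) (use assms(2) in \<open>auto intro: inj_on_subset\<close>)
qed

subsection \<open>A derivation and two uniqueness theorems\<close>

text \<open>Multiplying the Euler derivation by \<open>1 + 4X\<close> keeps all coefficients below polynomial.\<close>

definition euler :: "complex fps \<Rightarrow> complex fps" where
  "euler f = (1 + 4 * fps_X) * fps_X * fps_deriv f"

lemma euler_simps:
  "euler (f + g) = euler f + euler g" "euler (f - g) = euler f - euler g" "euler (f * g) = euler f * g + f * euler g"
  "euler (of_nat n) = 0" "euler (numeral w) = 0" "euler 1 = 0" "euler 0 = 0"
  "euler fps_X = (1 + 4 * fps_X) * fps_X"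
  by (simp_all add: euler_def algebra_simps)

lemma fps_mult_nth_lowest:
  fixes f g :: "'a::comm_ring_1 fps"
  assumes "\<And>j. j < d \<Longrightarrow> fps_nth g j = 0"
  shows "fps_nth (f * g) d = fps_nth f 0 * fps_nth g d"
proof -
  have "fps_nth (f * g) d = (\<Sum>j\<in>{0}. fps_nth f j * fps_nth g (d - j))"
    unfolding fps_mult_nth by (rule sum.mono_neutral_right) (auto simp: assms)
  then show ?thesis by simp
qed

text \<open>The factor \<open>1 + 4 * fps_X\<close> has constant term 1, so on the lowest
  coefficient \<open>euler\<close> acts like the plain Euler derivation.\<close>

lemma euler_nth_lowest:
  assumes "\<And>j. j < d \<Longrightarrow> fps_nth g j = 0"
  shows "fps_nth (euler g) d = of_nat d * fps_nth g d"
proof -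
  have "fps_nth (euler g) d = fps_nth ((1 + 4 * fps_X) * (fps_X * fps_deriv g)) d"
    by (simp add: euler_def mult.assoc)
  also have "\<dots> = fps_nth (fps_X * fps_deriv g) d"
    by (subst fps_mult_nth_lowest) (auto simp: assms)
  finally show ?thesis by (cases d) auto
qed

lemma euler_nth_below:
  assumes "\<And>j. j < d \<Longrightarrow> fps_nth g j = 0" "i < d"
  shows "fps_nth (euler g) i = 0"
  using euler_nth_lowest[of i g] assms by simp

lemma fps_mult_nth_below:
  fixes f g :: "'a::comm_ring_1 fps"
  assumes "\<And>j. j < d \<Longrightarrow> fps_nth g j = 0" "i < d"
  shows "fps_nth (f * g) i = 0"
  using fps_mult_nth_lowest[of i g f] assms by simp

text \<open>When all coefficients below degree \<open>d\<close> vanish, comparing coefficients in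
  degree \<open>d\<close> leaves only the indicial polynomial \<open>2 * d^2 - d\<close>. Its roots
  are 0 and 1/2, so induction kills every coefficient of positive degree.\<close>

lemma second_order_ode_unique:
  assumes ode: "2 * (1 - 4 * fps_X) * euler (euler f) = (1 + fps_X * p) * euler f + fps_X * q * f"
  assumes "fps_nth f 0 = 0"
  shows "f = 0"
proof -
  have "fps_nth f d = 0" for d
  proof (induction d rule: less_induct)
    case (less d)
    note b0 = less
    note b1 = euler_nth_below[of d, OF b0]
    note b2 = euler_nth_below[of d, OF b1]
    have "fps_nth (2 * (1 - 4 * fps_X) * euler (euler f)) d = 2 * of_nat d ^ 2 * fps_nth f d"
      using euler_nth_lowest[of d, OF b1] euler_nth_lowest[of d, OF b0]
      by (subst fps_mult_nth_lowest) (auto simp: b2 power2_eq_square)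
    moreover have "fps_nth ((1 + fps_X * p) * euler f) d = of_nat d * fps_nth f d"
      using euler_nth_lowest[of d, OF b0] by (subst fps_mult_nth_lowest) (auto simp: b1)
    moreover have "fps_nth (fps_X * q * f) d = 0"
      by (subst fps_mult_nth_lowest) (auto simp: b0)
    ultimately have "of_nat d * (2 * of_nat d - 1) * fps_nth f d = 0"
      using arg_cong[OF ode, of "\<lambda>g. fps_nth g d"] by (simp add: power2_eq_square algebra_simps)
    moreover have "2 * of_nat d - 1 \<noteq> (0 :: complex)"
    proof
      assume "2 * of_nat d - 1 = (0 :: complex)"
      then have "of_nat (2 * d) = (of_nat 1 :: complex)" by simp
      then have "2 * d = 1" unfolding of_nat_eq_iff .
      then show False by presburger
    qed
    ultimately show ?case using assms(2) by (cases "d = 0") auto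
  qed
  then show ?thesis by (simp add: fps_eq_iff)
qed

text \<open>Here the indicial polynomial is \<open>d^3\<close> up to the nonzero factor
  \<open>fps_nth a 0\<close>; the factor \<open>fps_X\<close> on the right pushes all other terms to
  higher degree.\<close>

lemma third_order_ode_unique:
  assumes ode: "a * euler (euler (euler f)) = fps_X * (p * f + q * euler f + r * euler (euler f))"
  assumes "fps_nth f 0 = 0" "fps_nth a 0 \<noteq> 0"
  shows "f = 0"
proof -
  have "fps_nth f d = 0" for d
  proof (induction d rule: less_induct)
    case (less d)
    note b0 = less
    note b1 = euler_nth_below[of d, OF b0]
    note b2 = euler_nth_below[of d, OF b1]
    note b3 = euler_nth_below[of d, OF b2]
    have "fps_nth (a * euler (euler (euler f))) d = fps_nth a 0 * of_nat d ^ 3 * fps_nth f d"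
      using euler_nth_lowest[of d, OF b2] euler_nth_lowest[of d, OF b1] euler_nth_lowest[of d, OF b0]
      by (subst fps_mult_nth_lowest) (auto simp: b3 power3_eq_cube)
    moreover have "fps_nth (fps_X * (p * f + q * euler f + r * euler (euler f))) d = 0"
      by (subst fps_mult_nth_lowest)
         (auto simp: fps_mult_nth_below[of d, OF b0] fps_mult_nth_below[of d, OF b1] fps_mult_nth_below[of d, OF b2])
    ultimately show ?case using assms by (cases "d = 0") auto
  qed
  then show ?thesis by (simp add: fps_eq_iff)
qed

subsection \<open>The double series\<close>

lemma central_binomial_Suc:
  "Suc n * ((2 * Suc n) choose Suc n) = 2 * (2 * n + 1) * ((2 * n) choose n)"
proof -
  \<comment> \<open>The extra factor \<open>Suc n\<close>, cancelled at the end, allows binomial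
    absorption to be applied twice without division.\<close>
  have "Suc n * (Suc n * ((2 * Suc n) choose Suc n)) = Suc n * ((2 * Suc n) * ((2 * n + 1) choose n))"
    using Suc_times_binomial_eq[of "2 * n + 1" n]
    by (simp del: binomial_Suc_Suc add: mult.commute[of "Suc n"] mult.left_commute)
  also have "\<dots> = 2 * Suc n * (Suc n * ((2 * n + 1) choose n))"
    by (simp only: mult_ac)
  also have "Suc n * ((2 * n + 1) choose n) = (2 * n + 1) * ((2 * n) choose n)"
    using binomial_absorb_comp[of "2 * n + 1" n] by simp
  also have "2 * Suc n * ((2 * n + 1) * ((2 * n) choose n)) =
      Suc n * (2 * (2 * n + 1) * ((2 * n) choose n))"
    by (simp only: mult_ac)
  finally show ?thesis
    by (simp only: mult_cancel1) simp
qed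

definition inv_one_plus_4X :: "complex fps" where "inv_one_plus_4X = inverse (1 + 4 * fps_X)"

lemma inv_one_plus_4X_mult: "inv_one_plus_4X * (1 + 4 * fps_X) = 1"
  unfolding inv_one_plus_4X_def by (rule inverse_mult_eq_1) simp

lemma euler_inv_one_plus_4X: "euler inv_one_plus_4X = - 4 * fps_X * inv_one_plus_4X"
proof -
  have "fps_deriv inv_one_plus_4X = - 4 * inv_one_plus_4X ^ 2"
    unfolding inv_one_plus_4X_def by (subst fps_inverse_deriv) simp_all
  then have "euler inv_one_plus_4X = - 4 * fps_X * inv_one_plus_4X * (inv_one_plus_4X * (1 + 4 * fps_X))"
    by (simp add: euler_def power2_eq_square algebra_simps)
  then show ?thesis by (simp add: inv_one_plus_4X_mult)
qed

section \<open>Summands of the double series and their ratios\<close>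

definition lhs_coeff :: "nat \<Rightarrow> nat \<Rightarrow> nat" where
  "lhs_coeff k m = ((2 * (k + m)) choose (k + m)) * ((2 * k) choose k) ^ 2 * ((2 * m) choose m)"

text \<open>With \<open>n = k + m\<close>, the powers \<open>x^n\<close> and \<open>x^k\<close> of
  the left-hand side combine to exponent \<open>2 * k + m\<close>.\<close>

definition lhs_summand :: "nat \<Rightarrow> nat \<Rightarrow> complex fps" where
  "lhs_summand k m = of_nat (lhs_coeff k m) * (fps_X ^ (2 * k + m) * inv_one_plus_4X ^ (2 * (k + m)))"

lemma lhs_coeff_Suc_left:
  "(Suc k)\<^sup>2 * Suc (k + m) * lhs_coeff (Suc k) m =
   8 * Suc (2 * (k + m)) * (Suc (2 * k))\<^sup>2 * lhs_coeff k m"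
proof -
  have "(Suc k)\<^sup>2 * Suc (k + m) * lhs_coeff (Suc k) m =
     (Suc (k + m) * ((2 * Suc (k + m)) choose Suc (k + m))) *
     (Suc k * ((2 * Suc k) choose Suc k))\<^sup>2 * ((2 * m) choose m)"
    by (simp only: lhs_coeff_def power_mult_distrib add_Suc mult_ac)
  also have "\<dots> = 8 * Suc (2 * (k + m)) * (Suc (2 * k))\<^sup>2 * lhs_coeff k m"
    unfolding central_binomial_Suc by (simp add: lhs_coeff_def power2_eq_square algebra_simps)
  finally show ?thesis .
qed

lemma lhs_coeff_Suc_right:
  "Suc m * Suc (k + m) * lhs_coeff k (Suc m) = 4 * Suc (2 * (k + m)) * Suc (2 * m) * lhs_coeff k m"
proof -
  have "Suc m * Suc (k + m) * lhs_coeff k (Suc m) =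
     (Suc (k + m) * ((2 * Suc (k + m)) choose Suc (k + m))) *
     ((2 * k) choose k)\<^sup>2 * (Suc m * ((2 * Suc m) choose Suc m))"
    by (simp only: lhs_coeff_def add_Suc_right mult_ac)
  also have "\<dots> = 4 * Suc (2 * (k + m)) * Suc (2 * m) * lhs_coeff k m"
    unfolding central_binomial_Suc by (simp add: lhs_coeff_def algebra_simps)
  finally show ?thesis .
qed

lemma inv_one_plus_4X_power_cancel:
  "(1 + 4 * fps_X)\<^sup>2 * inv_one_plus_4X ^ (2 * Suc n) = inv_one_plus_4X ^ (2 * n)"
proof -
  have "(1 + 4 * fps_X)\<^sup>2 * inv_one_plus_4X ^ (2 * Suc n) = (inv_one_plus_4X * (1 + 4 * fps_X))\<^sup>2 * inv_one_plus_4X ^ (2 * n)"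
    by (simp add: power2_eq_square algebra_simps)
  then show ?thesis by (simp add: inv_one_plus_4X_mult)
qed

text \<open>The ratio of neighbouring summands is rational in \<open>k\<close>, \<open>m\<close> and
  \<open>fps_X\<close>; this is its denominator-free form. The factor
  \<open>(1 + 4 * fps_X)^2\<close> appears because raising \<open>k\<close> also raises
  \<open>n = k + m\<close>.\<close>

lemma lhs_summand_Suc_left:
  "(1 + 4 * fps_X)\<^sup>2 * (1 + of_nat k)\<^sup>2 * (1 + (of_nat k + of_nat m)) * lhs_summand (Suc k) m =
   8 * fps_X\<^sup>2 * (1 + 2 * (of_nat k + of_nat m)) * (1 + 2 * of_nat k)\<^sup>2 * lhs_summand k m"
proof -
  have 2: "(1 + of_nat k)\<^sup>2 * (1 + (of_nat k + of_nat m)) * of_nat (lhs_coeff (Suc k) m) =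
    (8 * (1 + 2 * (of_nat k + of_nat m)) * (1 + 2 * of_nat k)\<^sup>2 * of_nat (lhs_coeff k m) :: complex fps)"
    using lhs_coeff_Suc_left[of k m, THEN arg_cong[where f = "of_nat :: nat \<Rightarrow> complex fps"]]
    by (simp only: of_nat_mult of_nat_power of_nat_Suc of_nat_add of_nat_numeral)
  have "(1 + 4 * fps_X)\<^sup>2 * (1 + of_nat k)\<^sup>2 * (1 + (of_nat k + of_nat m)) * lhs_summand (Suc k) m =
    ((1 + of_nat k)\<^sup>2 * (1 + (of_nat k + of_nat m)) * of_nat (lhs_coeff (Suc k) m)) *
     fps_X ^ (2 * Suc k + m) * ((1 + 4 * fps_X)\<^sup>2 * inv_one_plus_4X ^ (2 * Suc (k + m)))"
    unfolding lhs_summand_def by (simp only: add_Suc mult_ac)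
  also have "\<dots> = 8 * fps_X\<^sup>2 * (1 + 2 * (of_nat k + of_nat m)) * (1 + 2 * of_nat k)\<^sup>2 * lhs_summand k m"
    unfolding inv_one_plus_4X_power_cancel 2 by (simp add: lhs_summand_def power2_eq_square mult_ac)
  finally show ?thesis .
qed

lemma lhs_summand_Suc_right:
  "(1 + 4 * fps_X)\<^sup>2 * (1 + of_nat m) * (1 + (of_nat k + of_nat m)) * lhs_summand k (Suc m) =
   4 * fps_X * (1 + 2 * (of_nat k + of_nat m)) * (1 + 2 * of_nat m) * lhs_summand k m"
proof -
  have 2: "(1 + of_nat m) * (1 + (of_nat k + of_nat m)) * of_nat (lhs_coeff k (Suc m)) =
    (4 * (1 + 2 * (of_nat k + of_nat m)) * (1 + 2 * of_nat m) * of_nat (lhs_coeff k m) :: complex fps)"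
    using lhs_coeff_Suc_right[of m k, THEN arg_cong[where f = "of_nat :: nat \<Rightarrow> complex fps"]]
    by (simp only: of_nat_mult of_nat_power of_nat_Suc of_nat_add of_nat_numeral)
  have "(1 + 4 * fps_X)\<^sup>2 * (1 + of_nat m) * (1 + (of_nat k + of_nat m)) * lhs_summand k (Suc m) =
    ((1 + of_nat m) * (1 + (of_nat k + of_nat m)) * of_nat (lhs_coeff k (Suc m))) *
     fps_X ^ (2 * k + Suc m) * ((1 + 4 * fps_X)\<^sup>2 * inv_one_plus_4X ^ (2 * Suc (k + m)))"
    unfolding lhs_summand_def by (simp only: add_Suc_right mult_ac)
  also have "\<dots> = 4 * fps_X * (1 + 2 * (of_nat k + of_nat m)) * (1 + 2 * of_nat m) * lhs_summand k m"
    unfolding inv_one_plus_4X_power_cancel 2 by (simp add: lhs_summand_def mult_ac)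
  finally show ?thesis .
qed

lemma lhs_summand_nth_eq_0: "N < k + m \<Longrightarrow> fps_nth (lhs_summand k m) N = 0"
  by (simp add: lhs_summand_def fps_X_power_mult_nth mult.left_commute[of "of_nat _"])

text \<open>Logarithmic differentiation: the power of \<open>fps_X\<close> contributes
  \<open>(2 * k + m) * (1 + 4 * fps_X)\<close> and the power of the inverse contributes
  \<open>- 8 * (k + m) * fps_X\<close>.\<close>

lemma euler_lhs_summand:
  "euler (lhs_summand k m) = (2 * of_nat k + (1 - 4 * fps_X) * of_nat m) * lhs_summand k m"
proof -
  have X: "euler (fps_X ^ n) = of_nat n * (1 + 4 * fps_X) * fps_X ^ n" for n
    by (induction n) (simp_all add: euler_simps algebra_simps)
  have Wn: "euler (inv_one_plus_4X ^ n) = - 4 * of_nat n * fps_X * inv_one_plus_4X ^ n" for n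
    by (induction n) (simp_all add: euler_simps euler_inv_one_plus_4X algebra_simps)
  show ?thesis
    unfolding lhs_summand_def by (simp add: euler_simps X Wn algebra_simps)
qed

lemma locally_finite_lhs_summand: "locally_finite_fps (\<lambda>(k, m). lhs_summand k m)"
  unfolding locally_finite_fps_def
proof
  fix N
  have "{i. fps_nth (case i of (k, m) \<Rightarrow> lhs_summand k m) N \<noteq> 0} \<subseteq> {..N} \<times> {..N}"
    using lhs_summand_nth_eq_0 by (auto simp: not_less[symmetric] simp del: not_less)
  then show "finite {i. fps_nth (case i of (k, m) \<Rightarrow> lhs_summand k m) N \<noteq> 0}"
    by (rule finite_subset) auto
qed

section \<open>Weighted double sums: linearity, Euler derivation and shift relations\<close>

definition lhs_sum :: "(nat \<Rightarrow> nat \<Rightarrow> complex fps) \<Rightarrow> complex fps" where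
  "lhs_sum P = fps_Sum (\<lambda>(k, m). P k m * lhs_summand k m)"

lemma locally_finite_lhs_sum: "locally_finite_fps (\<lambda>(k, m). P k m * lhs_summand k m)"
  using locally_finite_fps_mult[OF locally_finite_lhs_summand, of "\<lambda>(k, m). P k m"]
  by (simp add: case_prod_unfold)

lemma lhs_sum_cong: "(\<And>k m. P k m = Q k m) \<Longrightarrow> lhs_sum P = lhs_sum Q"
  by presburger

lemma lhs_sum_add: "lhs_sum P + lhs_sum Q = lhs_sum (\<lambda>k m. P k m + Q k m)"
  using fps_Sum_add[OF locally_finite_lhs_sum[of P] locally_finite_lhs_sum[of Q]]
  by (simp add: lhs_sum_def case_prod_unfold algebra_simps)

lemma lhs_sum_cmult: "c * lhs_sum P = lhs_sum (\<lambda>k m. c * P k m)"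
  using fps_Sum_cmult[OF locally_finite_lhs_sum[of P], of c]
  by (simp add: lhs_sum_def case_prod_unfold algebra_simps)

lemma lhs_sum_diff: "lhs_sum P - lhs_sum Q = lhs_sum (\<lambda>k m. P k m - Q k m)"
proof -
  have "lhs_sum P - lhs_sum Q = lhs_sum P + (- 1) * lhs_sum Q" by simp
  then show ?thesis unfolding lhs_sum_cmult lhs_sum_add by simp
qed

text \<open>The product rule on the level of weights. Weights may contain \<open>fps_X\<close>,
  hence the term \<open>euler (P k m)\<close>.\<close>

definition lhs_deriv :: "(nat \<Rightarrow> nat \<Rightarrow> complex fps) \<Rightarrow> nat \<Rightarrow> nat \<Rightarrow> complex fps" where
  "lhs_deriv P k m = (2 * of_nat k + (1 - 4 * fps_X) * of_nat m) * P k m + euler (P k m)"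

lemma euler_lhs_sum: "euler (lhs_sum P) = lhs_sum (lhs_deriv P)"
proof -
  let ?f = "\<lambda>(k, m). P k m * lhs_summand k m"
  have "euler (lhs_sum P) = fps_Sum (\<lambda>i. (1 + 4 * fps_X) * fps_X * fps_deriv (?f i))"
    unfolding euler_def lhs_sum_def fps_deriv_fps_Sum[OF locally_finite_lhs_sum]
    by (rule fps_Sum_cmult[symmetric]) (rule locally_finite_fps_deriv[OF locally_finite_lhs_sum])
  also have "(\<lambda>i. (1 + 4 * fps_X) * fps_X * fps_deriv (?f i)) = (\<lambda>i. euler (?f i))"
    by (simp add: euler_def)
  also have "\<dots> = (\<lambda>(k, m). lhs_deriv P k m * lhs_summand k m)"
    by (auto simp: fun_eq_iff lhs_deriv_def euler_simps euler_lhs_summand algebra_simps)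
  finally show ?thesis unfolding lhs_sum_def .
qed

text \<open>Replacing \<open>k\<close> by \<open>Suc k\<close> costs nothing, because the factor
  \<open>(of_nat k)^2\<close> annihilates the boundary terms \<open>k = 0\<close>; the ratio
  relation then rewrites the shifted summand.\<close>

lemma lhs_sum_shift_left:
  "lhs_sum (\<lambda>k m. (1 + 4 * fps_X)\<^sup>2 * (of_nat k)\<^sup>2 * (of_nat k + of_nat m) * p k m) =
   lhs_sum (\<lambda>k m. 8 * fps_X\<^sup>2 * (1 + 2 * (of_nat k + of_nat m)) * (1 + 2 * of_nat k)\<^sup>2 * p (Suc k) m)"
proof -
  let ?f = "\<lambda>(k, m). (1 + 4 * fps_X)\<^sup>2 * (of_nat k)\<^sup>2 * (of_nat k + of_nat m) * p k m * lhs_summand k m"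
  let ?h = "\<lambda>(k, m). (Suc k, m)"
  have "fps_Sum (\<lambda>i. ?f (?h i)) = fps_Sum ?f"
  proof (rule fps_Sum_reindex)
    show "locally_finite_fps ?f" by (rule locally_finite_lhs_sum)
    show "inj ?h" by (auto simp: inj_def)
    show "?f i = 0" if "i \<notin> range ?h" for i
    proof (cases i)
      case (Pair k m)
      with that have "k = 0" by (cases k) auto
      then show ?thesis using Pair by simp
    qed
  qed
  moreover have "(\<lambda>i. ?f (?h i)) = (\<lambda>(k, m).
    8 * fps_X\<^sup>2 * (1 + 2 * (of_nat k + of_nat m)) * (1 + 2 * of_nat k)\<^sup>2 * p (Suc k) m * lhs_summand k m)"
  proof
    fix i :: "nat \<times> nat"
    obtain k m where i: "i = (k, m)" by (cases i)
    show "?f (?h i) = (case i of (k, m) \<Rightarrow>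
      8 * fps_X\<^sup>2 * (1 + 2 * (of_nat k + of_nat m)) * (1 + 2 * of_nat k)\<^sup>2 * p (Suc k) m * lhs_summand k m)"
      unfolding i using arg_cong[OF lhs_summand_Suc_left[of k m], of "\<lambda>u. p (Suc k) m * u"]
      by (simp only: prod.case of_nat_Suc) (simp only: ac_simps)
  qed
  ultimately show ?thesis
    unfolding lhs_sum_def by simp
qed

lemma lhs_sum_shift_right:
  "lhs_sum (\<lambda>k m. (1 + 4 * fps_X)\<^sup>2 * of_nat m * (of_nat k + of_nat m) * p k m) =
   lhs_sum (\<lambda>k m. 4 * fps_X * (1 + 2 * (of_nat k + of_nat m)) * (1 + 2 * of_nat m) * p k (Suc m))"
proof -
  let ?f = "\<lambda>(k, m). (1 + 4 * fps_X)\<^sup>2 * of_nat m * (of_nat k + of_nat m) * p k m * lhs_summand k m"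
  let ?h = "\<lambda>(k, m). (k, Suc m)"
  have "fps_Sum (\<lambda>i. ?f (?h i)) = fps_Sum ?f"
  proof (rule fps_Sum_reindex)
    show "locally_finite_fps ?f" by (rule locally_finite_lhs_sum)
    show "inj ?h" by (auto simp: inj_def)
    show "?f i = 0" if "i \<notin> range ?h" for i
    proof (cases i)
      case (Pair k m)
      with that have "m = 0" by (cases m) auto
      then show ?thesis using Pair by simp
    qed
  qed
  moreover have "(\<lambda>i. ?f (?h i)) = (\<lambda>(k, m).
    4 * fps_X * (1 + 2 * (of_nat k + of_nat m)) * (1 + 2 * of_nat m) * p k (Suc m) * lhs_summand k m)"
  proof
    fix i :: "nat \<times> nat"
    obtain k m where i: "i = (k, m)" by (cases i)
    show "?f (?h i) = (case i of (k, m) \<Rightarrow>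
      4 * fps_X * (1 + 2 * (of_nat k + of_nat m)) * (1 + 2 * of_nat m) * p k (Suc m) * lhs_summand k m)"
      unfolding i using arg_cong[OF lhs_summand_Suc_right[of m k], of "\<lambda>u. p k (Suc m) * u"]
      by (simp only: prod.case of_nat_Suc) (simp only: ac_simps)
  qed
  ultimately show ?thesis
    unfolding lhs_sum_def by simp
qed

text \<open>Every pair \<open>p\<close>, \<open>q\<close> yields a weight whose sum vanishes. A
  linear relation between weighted sums is proved by exhibiting a pair for which this weight is the
  required combination.\<close>

lemma lhs_sum_telescope:
  "lhs_sum (\<lambda>k m.
     8 * fps_X\<^sup>2 * (1 + 2 * (of_nat k + of_nat m)) * (1 + 2 * of_nat k)\<^sup>2 * p (Suc k) m -
     (1 + 4 * fps_X)\<^sup>2 * (of_nat k)\<^sup>2 * (of_nat k + of_nat m) * p k m +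
    (4 * fps_X * (1 + 2 * (of_nat k + of_nat m)) * (1 + 2 * of_nat m) * q k (Suc m) -
     (1 + 4 * fps_X)\<^sup>2 * of_nat m * (of_nat k + of_nat m) * q k m)) = 0"
  unfolding lhs_sum_add[symmetric] lhs_sum_diff[symmetric] lhs_sum_shift_left lhs_sum_shift_right by simp

text \<open>
  The vanishing of \<open>lhs_sum satellite\<close> determines the contribution of \<open>a\<close> from that of \<open>b\<close>. It is not a
  telescoping identity itself; only the differential equation below is. Both pairs of certificates
  \<open>q1\<close>, \<open>q2\<close> were found by linear algebra over the rational functions in \<open>X\<close>; the spurious factor
  \<open>fps_X\<close> clears their denominators.
\<close>

definition satellite :: "nat \<Rightarrow> nat \<Rightarrow> complex fps" where
  "satellite k m = (1 - 4 * fps_X) * of_nat m - (1 + 12 * fps_X) * of_nat k - 4 * fps_X"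

lemma lhs_sum_satellite_ode:
  "4 * fps_X * (1 - 4 * fps_X) * lhs_sum (lhs_deriv (lhs_deriv satellite))
     - 2 * fps_X * (1 + 48 * fps_X - 80 * fps_X\<^sup>2) * lhs_sum (lhs_deriv satellite)
     - 4 * fps_X * (6 * fps_X - 96 * fps_X\<^sup>2 + 32 * fps_X ^ 3) * lhs_sum satellite = 0"
proof -
  define q1 :: "nat \<Rightarrow> nat \<Rightarrow> complex fps" where
    "q1 k m = 4 * fps_X * (6 + 8 * fps_X) - (1 - 4 * fps_X)\<^sup>2 * (1 + 4 * fps_X) * of_nat m" for k m
  define q2 :: "nat \<Rightarrow> nat \<Rightarrow> complex fps" where
    "q2 k m = 2 * fps_X * (1 - 4 * fps_X) * (1 + 12 * fps_X)
        - 4 * fps_X * (1 - 4 * fps_X)\<^sup>2 * of_nat m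
        - 4 * fps_X * (2 + 96 * fps_X\<^sup>2) * of_nat k
        + (1 - 4 * fps_X) * (1 + 4 * fps_X) * (1 + 12 * fps_X) * (of_nat k)\<^sup>2" for k m
  show ?thesis
    unfolding lhs_sum_cmult lhs_sum_diff
    \<comment> \<open>It suffices that the two weights agree, which is a polynomial identity in
      \<open>of_nat k\<close>, \<open>of_nat m\<close> and \<open>fps_X\<close>.\<close>
    by (rule trans[OF lhs_sum_cong lhs_sum_telescope[of q1 q2]])
       (unfold q1_def q2_def lhs_deriv_def satellite_def of_nat_Suc euler_simps, algebra)
qed

lemma lhs_sum_nth:
  "fps_nth (lhs_sum P) N = (\<Sum>(k, m)\<in>{(k, m). k + m \<le> N}. fps_nth (P k m * lhs_summand k m) N)"
proof -
  let ?A = "{(k, m). k + m \<le> N}"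
  have "?A \<subseteq> {..N} \<times> {..N}" by auto
  then have fin: "finite ?A" by (rule finite_subset) auto
  have "fps_nth (P k m * lhs_summand k m) N = 0" if "N < k + m" for k m
    by (rule fps_mult_nth_below[of "k + m"]) (use that in \<open>auto simp: lhs_summand_nth_eq_0\<close>)
  then have "{i. fps_nth (case i of (k, m) \<Rightarrow> P k m * lhs_summand k m) N \<noteq> 0} \<subseteq> ?A"
    by (auto simp: not_less[symmetric] simp del: not_less)
  then show ?thesis
    unfolding lhs_sum_def by (subst fps_Sum_nth[OF fin]) (auto simp: case_prod_unfold)
qed

lemma lhs_sum_nth_0: "fps_nth (lhs_sum P) 0 = fps_nth (P 0 0) 0"
  by (simp add: lhs_sum_nth lhs_summand_def lhs_coeff_def)

lemma lhs_sum_satellite_eq_0: "lhs_sum satellite = 0"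
proof (rule second_order_ode_unique)
  have "2 * fps_X * (2 * (1 - 4 * fps_X) * euler (euler (lhs_sum satellite)) -
      ((1 + fps_X * (48 - 80 * fps_X)) * euler (lhs_sum satellite) +
       fps_X * (12 - 192 * fps_X + 64 * fps_X\<^sup>2) * lhs_sum satellite)) = 0"
    using lhs_sum_satellite_ode unfolding euler_lhs_sum by algebra
  then show "2 * (1 - 4 * fps_X) * euler (euler (lhs_sum satellite)) =
      (1 + fps_X * (48 - 80 * fps_X)) * euler (lhs_sum satellite) +
       fps_X * (12 - 192 * fps_X + 64 * fps_X\<^sup>2) * lhs_sum satellite"
    by simp
  show "fps_nth (lhs_sum satellite) 0 = 0"
    by (simp add: lhs_sum_nth_0 satellite_def)
qed

text \<open>Formulated for the weight \<open>k\<close> because \<open>3 * lhs_sum B\<close> will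
  turn out to be the Euler derivative of \<open>[1] / (1 + 4X)\<close>. This second order relation
  with source term \<open>[1]\<close> thereby becomes a third order equation for that
  quotient.\<close>

lemma lhs_sum_k_ode:
  defines "B \<equiv> \<lambda>k m. of_nat k :: complex fps"
  shows "(1 - 4 * fps_X)\<^sup>2 * (1 + 12 * fps_X) * euler (euler (lhs_sum B)) =
     (32 * fps_X ^ 2 + 64 * fps_X ^ 3 - 1024 * fps_X ^ 4 - 3072 * fps_X ^ 5) * lhs_sum (\<lambda>k m. 1)
     + (2 * fps_X + 264 * fps_X ^ 2 - 480 * fps_X ^ 3 - 4224 * fps_X ^ 4 - 9216 * fps_X ^ 5) * lhs_sum B
     + (6 * fps_X + 288 * fps_X ^ 2 + 288 * fps_X ^ 3) * (1 - 4 * fps_X) * euler (lhs_sum B)"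
proof -
  define q1 :: "nat \<Rightarrow> nat \<Rightarrow> complex fps" where
    "q1 k m = - 8 * fps_X * (1 - 4 * fps_X) * (5 + 12 * fps_X)
       + (1 - 4 * fps_X) ^ 3 * (1 + 12 * fps_X) * of_nat m" for k m
  define q2 :: "nat \<Rightarrow> nat \<Rightarrow> complex fps" where
    "q2 k m = fps_X * (1 - 4 * fps_X) * (1 + 12 * fps_X) * (40 * fps_X - 2)
        + 8 * fps_X * (1 - 4 * fps_X) * (1 + 12 * fps_X) * (12 * fps_X - 1) * of_nat k
        - (1 - 4 * fps_X)\<^sup>2 * (1 + 12 * fps_X)\<^sup>2 * (of_nat k)\<^sup>2" for k m
  \<comment> \<open>The last two terms are zero as sums, but not as weights: the certificates
    establish the relation only modulo \<open>satellite\<close> and its derivative.\<close>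
  have "8 * fps_X * (1 - 4 * fps_X)\<^sup>2 * (1 + 12 * fps_X) * lhs_sum (lhs_deriv (lhs_deriv B))
    - 8 * fps_X * (32 * fps_X ^ 2 + 64 * fps_X ^ 3 - 1024 * fps_X ^ 4 - 3072 * fps_X ^ 5) * lhs_sum (\<lambda>k m. 1)
    - 8 * fps_X * (2 * fps_X + 264 * fps_X ^ 2 - 480 * fps_X ^ 3 - 4224 * fps_X ^ 4 - 9216 * fps_X ^ 5) * lhs_sum B
    - 8 * fps_X * (6 * fps_X + 288 * fps_X ^ 2 + 288 * fps_X ^ 3) * (1 - 4 * fps_X) * lhs_sum (lhs_deriv B)
    - 8 * fps_X * (fps_X + 44 * fps_X ^ 2 - 400 * fps_X ^ 3 - 192 * fps_X ^ 4) * lhs_sum satellite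
    - 2 * fps_X * (12 * fps_X - 1) * (1 - 4 * fps_X) * (1 + 12 * fps_X) * lhs_sum (lhs_deriv satellite) = 0"
    unfolding lhs_sum_cmult lhs_sum_diff
    by (rule trans[OF lhs_sum_cong lhs_sum_telescope[of q1 q2]])
       (unfold q1_def q2_def B_def lhs_deriv_def satellite_def of_nat_Suc euler_simps, algebra)
  then have "8 * fps_X * ((1 - 4 * fps_X)\<^sup>2 * (1 + 12 * fps_X) * euler (euler (lhs_sum B)) -
     ((32 * fps_X ^ 2 + 64 * fps_X ^ 3 - 1024 * fps_X ^ 4 - 3072 * fps_X ^ 5) * lhs_sum (\<lambda>k m. 1)
     + (2 * fps_X + 264 * fps_X ^ 2 - 480 * fps_X ^ 3 - 4224 * fps_X ^ 4 - 9216 * fps_X ^ 5) * lhs_sum B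
     + (6 * fps_X + 288 * fps_X ^ 2 + 288 * fps_X ^ 3) * (1 - 4 * fps_X) * euler (lhs_sum B))) = 0"
    unfolding euler_lhs_sum[symmetric] lhs_sum_satellite_eq_0 euler_simps by algebra
  then show ?thesis by simp
qed

subsection \<open>The hypergeometric series\<close>

definition rhs_coeff :: "nat \<Rightarrow> nat" where
  "rhs_coeff n = ((3 * n) choose n) * ((2 * n) choose n)\<^sup>2"

lemma rhs_coeff_fact: "rhs_coeff n * fact n ^ 5 = fact (3 * n) * fact (2 * n)"
proof -
  have 1: "fact n * fact (2 * n) * ((3 * n) choose n) = (fact (3 * n) :: nat)"
    using binomial_fact_lemma[of n "3 * n"] by simp
  have 2: "fact n * fact n * ((2 * n) choose n) = (fact (2 * n) :: nat)"
    using binomial_fact_lemma[of n "2 * n"] by simp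
  \<comment> \<open>The product \<open>fact (2 * n) * fact n ^ 5\<close> is exactly what clears the
    denominators of all three binomial factors.\<close>
  have "fact (2 * n) * (rhs_coeff n * fact n ^ 5) =
      (fact n * fact (2 * n) * ((3 * n) choose n)) * (fact n * fact n * ((2 * n) choose n))\<^sup>2"
    unfolding rhs_coeff_def by (simp add: power_mult_distrib eval_nat_numeral)
  also have "\<dots> = fact (2 * n) * (fact (3 * n) * fact (2 * n))"
    unfolding 1 2 by (simp add: power2_eq_square)
  finally show ?thesis by simp
qed

lemma rhs_coeff_Suc:
  "Suc n ^ 3 * rhs_coeff (Suc n) = 6 * Suc (2 * n) * Suc (3 * n) * Suc (Suc (3 * n)) * rhs_coeff n"
proof -
  have 3: "fact (3 * Suc n) = 3 * Suc n * Suc (Suc (3 * n)) * Suc (3 * n) * (fact (3 * n) :: nat)"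
  proof -
    have "3 * Suc n = Suc (Suc (Suc (3 * n)))" by simp
    then show ?thesis by (simp only: fact_Suc of_nat_id)
  qed
  have 2: "fact (2 * Suc n) = 2 * Suc n * Suc (2 * n) * (fact (2 * n) :: nat)"
    by (simp add: algebra_simps)
  \<comment> \<open>Of the five factors \<open>Suc n\<close> in \<open>fact (Suc n) ^ 5\<close>,
    three belong to the claim; the other two cancel against those produced by
    \<open>fact (3 * Suc n)\<close> and \<open>fact (2 * Suc n)\<close>.\<close>
  have "Suc n ^ 2 * fact n ^ 5 * (Suc n ^ 3 * rhs_coeff (Suc n)) = rhs_coeff (Suc n) * fact (Suc n) ^ 5"
  proof -
    have "Suc n ^ 5 = Suc n ^ 2 * Suc n ^ 3" unfolding power_add[symmetric] by simp
    then show ?thesis by (simp only: fact_Suc power_mult_distrib of_nat_id mult_ac)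
  qed
  also have "\<dots> = 6 * Suc (2 * n) * Suc (3 * n) * Suc (Suc (3 * n)) * Suc n ^ 2 * (fact (3 * n) * fact (2 * n))"
    unfolding rhs_coeff_fact 2 3 by (simp add: power2_eq_square algebra_simps)
  also have "\<dots> = Suc n ^ 2 * fact n ^ 5 * (6 * Suc (2 * n) * Suc (3 * n) * Suc (Suc (3 * n)) * rhs_coeff n)"
    unfolding rhs_coeff_fact[symmetric] by (simp only: mult_ac)
  finally show ?thesis
    by (simp only: mult_cancel1) simp
qed

definition cubic_arg :: "complex fps" where "cubic_arg = fps_X\<^sup>2 * (1 - 4 * fps_X)"

definition rhs_summand :: "nat \<Rightarrow> complex fps" where "rhs_summand n = of_nat (rhs_coeff n) * cubic_arg ^ n"

lemma rhs_summand_nth_eq_0: "N < n \<Longrightarrow> fps_nth (rhs_summand n) N = 0"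
proof -
  assume "N < n"
  have "rhs_summand n = fps_X ^ (2 * n) * (of_nat (rhs_coeff n) * (1 - 4 * fps_X) ^ n)"
    by (simp add: rhs_summand_def cubic_arg_def power_mult_distrib mult_ac flip: power_mult)
  with \<open>N < n\<close> show ?thesis by (simp add: fps_X_power_mult_nth)
qed

lemma locally_finite_rhs_summand: "locally_finite_fps rhs_summand"
  unfolding locally_finite_fps_def
proof
  fix N
  have "{i. fps_nth (rhs_summand i) N \<noteq> 0} \<subseteq> {..N}"
    using rhs_summand_nth_eq_0 by (auto simp: not_less[symmetric] simp del: not_less)
  then show "finite {i. fps_nth (rhs_summand i) N \<noteq> 0}"
    by (rule finite_subset) auto
qed

lemma rhs_summand_Suc:
  "(1 + of_nat n) ^ 3 * rhs_summand (Suc n) =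
   6 * cubic_arg * (1 + 2 * of_nat n) * (1 + 3 * of_nat n) * (1 + (1 + 3 * of_nat n)) * rhs_summand n"
proof -
  have "(1 + of_nat n) ^ 3 * of_nat (rhs_coeff (Suc n)) =
    (6 * (1 + 2 * of_nat n) * (1 + 3 * of_nat n) * (1 + (1 + 3 * of_nat n)) * of_nat (rhs_coeff n) :: complex fps)"
    using rhs_coeff_Suc[of n, THEN arg_cong[where f = "of_nat :: nat \<Rightarrow> complex fps"]]
    by (simp only: of_nat_mult of_nat_power of_nat_Suc of_nat_add of_nat_numeral)
  from arg_cong[OF this, of "\<lambda>u. cubic_arg ^ Suc n * u"] show ?thesis
    unfolding rhs_summand_def by (simp only: power_Suc mult_ac)
qed

definition inv_one_minus_4X :: "complex fps" where "inv_one_minus_4X = inverse (1 - 4 * fps_X)"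

lemma inv_one_minus_4X_mult: "inv_one_minus_4X * (1 - 4 * fps_X) = 1"
  unfolding inv_one_minus_4X_def by (rule inverse_mult_eq_1) simp

lemma euler_inv_one_minus_4X:
  "euler inv_one_minus_4X = 4 * fps_X * (1 + 4 * fps_X) * (inv_one_minus_4X * inv_one_minus_4X)"
proof -
  have "fps_deriv inv_one_minus_4X = 4 * inv_one_minus_4X ^ 2"
    unfolding inv_one_minus_4X_def by (subst fps_inverse_deriv) simp_all
  then show ?thesis
    by (simp add: euler_def power2_eq_square algebra_simps)
qed

text \<open>The logarithmic derivative of \<open>cubic_arg\<close> introduces the denominator
  \<open>1 - 4 * fps_X\<close>.\<close>

lemma euler_rhs_summand:
  "euler (rhs_summand n) = of_nat n * (2 - 12 * fps_X) * (1 + 4 * fps_X) * inv_one_minus_4X * rhs_summand n"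
proof -
  have "euler cubic_arg = (2 - 12 * fps_X) * (1 + 4 * fps_X) * fps_X\<^sup>2 * (inv_one_minus_4X * (1 - 4 * fps_X))"
    unfolding inv_one_minus_4X_mult cubic_arg_def by (simp add: euler_simps power2_eq_square algebra_simps)
  then have *: "euler cubic_arg = ((2 - 12 * fps_X) * (1 + 4 * fps_X) * inv_one_minus_4X) * cubic_arg"
    by (simp add: cubic_arg_def algebra_simps)
  have "euler (cubic_arg ^ n) = of_nat n * l * cubic_arg ^ n" if "euler cubic_arg = l * cubic_arg" for l
    by (induction n) (simp_all add: euler_simps that algebra_simps)
  from this[OF *] show ?thesis by (simp add: rhs_summand_def euler_simps mult_ac)
qed

section \<open>Weighted hypergeometric sums and their differential equation\<close>

definition rhs_sum :: "(nat \<Rightarrow> complex fps) \<Rightarrow> complex fps" where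
  "rhs_sum P = fps_Sum (\<lambda>n. P n * rhs_summand n)"

lemma locally_finite_rhs_sum: "locally_finite_fps (\<lambda>n. P n * rhs_summand n)"
  by (rule locally_finite_fps_mult[OF locally_finite_rhs_summand])

lemma rhs_sum_cong: "(\<And>n. P n = Q n) \<Longrightarrow> rhs_sum P = rhs_sum Q"
  by presburger

lemma rhs_sum_add: "rhs_sum P + rhs_sum Q = rhs_sum (\<lambda>n. P n + Q n)"
  using fps_Sum_add[OF locally_finite_rhs_sum[of P] locally_finite_rhs_sum[of Q]]
  by (simp add: rhs_sum_def algebra_simps)

lemma rhs_sum_cmult: "c * rhs_sum P = rhs_sum (\<lambda>n. c * P n)"
  using fps_Sum_cmult[OF locally_finite_rhs_sum[of P], of c]
  by (simp add: rhs_sum_def algebra_simps)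

lemma rhs_sum_diff: "rhs_sum P - rhs_sum Q = rhs_sum (\<lambda>n. P n - Q n)"
proof -
  have "rhs_sum P - rhs_sum Q = rhs_sum P + (- 1) * rhs_sum Q" by simp
  then show ?thesis unfolding rhs_sum_cmult rhs_sum_add by simp
qed

definition rhs_deriv :: "(nat \<Rightarrow> complex fps) \<Rightarrow> nat \<Rightarrow> complex fps" where
  "rhs_deriv P n = of_nat n * (2 - 12 * fps_X) * (1 + 4 * fps_X) * inv_one_minus_4X * P n + euler (P n)"

lemma euler_rhs_sum: "euler (rhs_sum P) = rhs_sum (rhs_deriv P)"
proof -
  have "euler (rhs_sum P) = fps_Sum (\<lambda>n. (1 + 4 * fps_X) * fps_X * fps_deriv (P n * rhs_summand n))"
    unfolding euler_def rhs_sum_def fps_deriv_fps_Sum[OF locally_finite_rhs_sum]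
    by (rule fps_Sum_cmult[symmetric]) (rule locally_finite_fps_deriv[OF locally_finite_rhs_sum])
  also have "(\<lambda>n. (1 + 4 * fps_X) * fps_X * fps_deriv (P n * rhs_summand n)) = (\<lambda>n. euler (P n * rhs_summand n))"
    by (simp add: euler_def)
  also have "\<dots> = (\<lambda>n. rhs_deriv P n * rhs_summand n)"
    by (auto simp: fun_eq_iff rhs_deriv_def euler_simps euler_rhs_summand algebra_simps)
  finally show ?thesis unfolding rhs_sum_def .
qed

lemma rhs_sum_nth: "fps_nth (rhs_sum P) N = (\<Sum>n\<le>N. fps_nth (P n * rhs_summand n) N)"
proof -
  have "fps_nth (P n * rhs_summand n) N = 0" if "N < n" for n
    by (rule fps_mult_nth_below[of n]) (use that in \<open>auto simp: rhs_summand_nth_eq_0\<close>)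
  then have "{n. fps_nth (P n * rhs_summand n) N \<noteq> 0} \<subseteq> {..N}"
    by (auto simp: not_less[symmetric] simp del: not_less)
  then show ?thesis
    unfolding rhs_sum_def by (intro fps_Sum_nth) auto
qed

text \<open>The shift from \<open>n\<close> to \<open>Suc n\<close>, where the factor
  \<open>of_nat n ^ 3\<close> removes the boundary term \<open>n = 0\<close>. The certificate
  \<open>p\<close> is constant in \<open>n\<close>.\<close>

lemma rhs_sum_telescope:
  "rhs_sum (\<lambda>n. of_nat n ^ 3 * p - 6 * cubic_arg * (1 + 2 * of_nat n) * (1 + 3 * of_nat n) * (1 + (1 + 3 * of_nat n)) * p) = 0"
proof -
  have "fps_Sum (\<lambda>n. of_nat (Suc n) ^ 3 * p * rhs_summand (Suc n)) = fps_Sum (\<lambda>n. of_nat n ^ 3 * p * rhs_summand n)"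
  proof (rule fps_Sum_reindex)
    show "locally_finite_fps (\<lambda>n. of_nat n ^ 3 * p * rhs_summand n)" by (rule locally_finite_rhs_sum)
    show "of_nat n ^ 3 * p * rhs_summand n = 0" if "n \<notin> range Suc" for n
      using that by (cases n) auto
  qed auto
  moreover have "(\<lambda>n. of_nat (Suc n) ^ 3 * p * rhs_summand (Suc n)) =
      (\<lambda>n. 6 * cubic_arg * (1 + 2 * of_nat n) * (1 + 3 * of_nat n) * (1 + (1 + 3 * of_nat n)) * p * rhs_summand n)"
  proof
    fix n
    show "of_nat (Suc n) ^ 3 * p * rhs_summand (Suc n) =
      6 * cubic_arg * (1 + 2 * of_nat n) * (1 + 3 * of_nat n) * (1 + (1 + 3 * of_nat n)) * p * rhs_summand n"
      using arg_cong[OF rhs_summand_Suc[of n], of "\<lambda>u. p * u"]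
      by (simp only: of_nat_Suc ac_simps)
  qed
  ultimately show ?thesis
    unfolding rhs_sum_diff[symmetric] unfolding rhs_sum_def by simp
qed

text \<open>This is three times the equation of \<open>lhs_sum_k_ode\<close>, with
  \<open>(1 + 4 * fps_X) * f\<close> in place of \<open>[1]\<close> and \<open>euler f\<close> in
  place of \<open>3 * [k]\<close>.\<close>

definition rhs_ode :: "complex fps \<Rightarrow> bool" where
  "rhs_ode f \<longleftrightarrow> (1 - 4 * fps_X)\<^sup>2 * (1 + 12 * fps_X) * euler (euler (euler f)) =
     3 * (32 * fps_X ^ 2 + 64 * fps_X ^ 3 - 1024 * fps_X ^ 4 - 3072 * fps_X ^ 5) * (1 + 4 * fps_X) * f
     + (2 * fps_X + 264 * fps_X ^ 2 - 480 * fps_X ^ 3 - 4224 * fps_X ^ 4 - 9216 * fps_X ^ 5) * euler f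
     + (6 * fps_X + 288 * fps_X ^ 2 + 288 * fps_X ^ 3) * (1 - 4 * fps_X) * euler (euler f)"

lemma rhs_ode_rhs_sum: "rhs_ode (rhs_sum (\<lambda>n. 1))"
proof -
  let ?G = "\<lambda>n. 1 :: complex fps"
  have "(1 - 4 * fps_X)\<^sup>2 * (1 + 12 * fps_X) * rhs_sum (rhs_deriv (rhs_deriv (rhs_deriv ?G)))
     - 3 * (32 * fps_X ^ 2 + 64 * fps_X ^ 3 - 1024 * fps_X ^ 4 - 3072 * fps_X ^ 5) * (1 + 4 * fps_X) * rhs_sum ?G
     - (2 * fps_X + 264 * fps_X ^ 2 - 480 * fps_X ^ 3 - 4224 * fps_X ^ 4 - 9216 * fps_X ^ 5) * rhs_sum (rhs_deriv ?G)
     - (6 * fps_X + 288 * fps_X ^ 2 + 288 * fps_X ^ 3) * (1 - 4 * fps_X) * rhs_sum (rhs_deriv (rhs_deriv ?G)) = 0"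
    unfolding rhs_sum_cmult rhs_sum_diff
    \<comment> \<open>The certificate is found by comparing coefficients of \<open>n^3\<close>,
      where \<open>1 - 108 * cubic_arg = (1 - 6 * fps_X)^2 * (1 + 12 * fps_X)\<close>.\<close>
    by (rule trans[OF rhs_sum_cong rhs_sum_telescope[of
         "8 * (1 - 6 * fps_X) * (1 + 4 * fps_X) ^ 3 * inv_one_minus_4X"]])
       (insert inv_one_minus_4X_mult, unfold rhs_deriv_def cubic_arg_def euler_simps
          euler_inv_one_minus_4X, algebra)
  then show ?thesis
    unfolding rhs_ode_def euler_rhs_sum by (simp add: algebra_simps)
qed


section \<open>Identification of the two formal series\<close>

lemma lhs_sum_1_eq: "lhs_sum (\<lambda>k m. 1) = (1 + 4 * fps_X) * rhs_sum (\<lambda>n. 1)"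
  and lhs_sum_k_eq: "3 * lhs_sum (\<lambda>k m. of_nat k) = euler (rhs_sum (\<lambda>n. 1))"
proof -
  define F where "F = lhs_sum (\<lambda>k m. 1)"
  define B where "B = lhs_sum (\<lambda>k m. of_nat k)"
  define H where "H = inv_one_plus_4X * F"
  define D where "D = H - rhs_sum (\<lambda>n. 1)"
  have FH: "F = (1 + 4 * fps_X) * H"
    unfolding H_def using inv_one_plus_4X_mult by algebra
  \<comment> \<open>On weights: \<open>2k + (1 - 4X) m - 4X\<close> minus the satellite weight
    equals \<open>3 (1 + 4X) k\<close>, so the variable \<open>m\<close> drops out.\<close>
  have "euler F - 4 * fps_X * F - lhs_sum satellite = 3 * (1 + 4 * fps_X) * B"
    unfolding F_def B_def euler_lhs_sum lhs_sum_cmult lhs_sum_diff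
    by (rule lhs_sum_cong) (unfold lhs_deriv_def satellite_def euler_simps, algebra)
  then have "euler F - 4 * fps_X * F = 3 * (1 + 4 * fps_X) * B"
    by (simp add: lhs_sum_satellite_eq_0)
  then have eulH: "euler H = 3 * B"
    unfolding H_def euler_simps euler_inv_one_plus_4X using inv_one_plus_4X_mult by algebra
  have "rhs_ode H"
    using lhs_sum_k_ode unfolding rhs_ode_def eulH euler_simps F_def[symmetric] B_def[symmetric] FH by algebra
  \<comment> \<open>Subtracting the two instances of \<open>rhs_ode\<close>; every lower order
    coefficient is divisible by \<open>fps_X\<close>, as the uniqueness lemma demands.\<close>
  with rhs_ode_rhs_sum have "(1 - 4 * fps_X)\<^sup>2 * (1 + 12 * fps_X) * euler (euler (euler D)) = fps_X * (
     (3 * (32 * fps_X + 64 * fps_X ^ 2 - 1024 * fps_X ^ 3 - 3072 * fps_X ^ 4) * (1 + 4 * fps_X)) * D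
     + (2 + 264 * fps_X - 480 * fps_X ^ 2 - 4224 * fps_X ^ 3 - 9216 * fps_X ^ 4) * euler D
     + ((6 + 288 * fps_X + 288 * fps_X ^ 2) * (1 - 4 * fps_X)) * euler (euler D))"
    unfolding rhs_ode_def D_def euler_simps by algebra
  \<comment> \<open>Both series have constant term 1.\<close>
  moreover have "fps_nth D 0 = 0"
    by (simp add: D_def H_def F_def inv_one_plus_4X_def lhs_sum_nth_0 rhs_sum_nth rhs_summand_def
        rhs_coeff_def cubic_arg_def)
  ultimately have "D = 0"
    by (rule third_order_ode_unique) simp
  then have "H = rhs_sum (\<lambda>n. 1)" by (simp add: D_def)
  then show "lhs_sum (\<lambda>k m. 1) = (1 + 4 * fps_X) * rhs_sum (\<lambda>n. 1)"
    and "3 * lhs_sum (\<lambda>k m. of_nat k) = euler (rhs_sum (\<lambda>n. 1))"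
    using FH eulH by (simp_all add: F_def B_def)
qed

text \<open>Since \<open>n = k + m\<close>, the weight \<open>n\<close> gives
  \<open>[k] + [m]\<close>. The vanishing satellite expresses \<open>[m]\<close> through
  \<open>[k]\<close> and \<open>[1]\<close>, and \<open>[k]\<close> is a third of the Euler
  derivative of the hypergeometric series. Collecting terms produces the coefficients
  \<open>A\<close> and \<open>B\<close>.\<close>

lemma lhs_sum_linear_eq:
  "lhs_sum (\<lambda>k m. fps_const a * (of_nat k + of_nat m) + fps_const b) =
   4 * fps_const a * (1 + 4 * fps_X)\<^sup>2 * (1 - 6 * fps_X) * (fps_const (1/3) * inv_one_minus_4X\<^sup>2) * rhs_sum of_nat
   + (1 + 4 * fps_X) * (4 * fps_const a * fps_X * inv_one_minus_4X + fps_const b) * rhs_sum (\<lambda>n. 1)"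
proof -
  have M: "(1 - 4 * fps_X) * lhs_sum (\<lambda>k m. of_nat m) =
     (1 + 12 * fps_X) * lhs_sum (\<lambda>k m. of_nat k) + 4 * fps_X * lhs_sum (\<lambda>k m. 1)"
  proof -
    have "(1 - 4 * fps_X) * lhs_sum (\<lambda>k m. of_nat m) - (1 + 12 * fps_X) * lhs_sum (\<lambda>k m. of_nat k)
       - 4 * fps_X * lhs_sum (\<lambda>k m. 1) = lhs_sum satellite"
      unfolding lhs_sum_cmult lhs_sum_diff by (rule lhs_sum_cong) (simp add: satellite_def)
    then show ?thesis unfolding lhs_sum_satellite_eq_0 by algebra
  qed
  have lin: "lhs_sum (\<lambda>k m. fps_const a * (of_nat k + of_nat m) + fps_const b) =
    fps_const a * (lhs_sum (\<lambda>k m. of_nat k) + lhs_sum (\<lambda>k m. of_nat m)) + fps_const b * lhs_sum (\<lambda>k m. 1)"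
    unfolding lhs_sum_cmult lhs_sum_add by (rule lhs_sum_cong) simp
  have E: "3 * lhs_sum (\<lambda>k m. of_nat k) = (2 - 12 * fps_X) * (1 + 4 * fps_X) * inv_one_minus_4X * rhs_sum of_nat"
    unfolding lhs_sum_k_eq euler_rhs_sum rhs_sum_cmult
    by (rule rhs_sum_cong) (simp add: rhs_deriv_def euler_simps mult_ac)
  have third: "3 * fps_const (1/3) = (1 :: complex fps)"
    by (simp add: numeral_fps_const)
  show ?thesis
    unfolding lin using M E lhs_sum_1_eq inv_one_minus_4X_mult third by algebra
qed

subsection \<open>Convergence\<close>

text \<open>This carries formal identities over to functions near 0. By the M-test the partial sums
  converge uniformly, so the limit is holomorphic and its derivatives at 0 are the limits of theirs;
  hence its Taylor coefficients are the coefficientwise sums.\<close>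

lemma has_fps_expansion_suminf:
  fixes f :: "nat \<Rightarrow> complex \<Rightarrow> complex"
  assumes "r > 0"
    and holo: "\<And>n. f n holomorphic_on ball 0 r"
    and bound: "\<And>n x. x \<in> ball 0 r \<Longrightarrow> norm (f n x) \<le> M n" and M: "summable M"
    and exp: "\<And>n. f n has_fps_expansion F n"
    and coeffs: "\<And>N. (\<lambda>n. fps_nth (F n) N) sums fps_nth G N"
  shows "(\<lambda>x. \<Sum>n. f n x) has_fps_expansion G"
proof -
  let ?s = "\<lambda>n x. \<Sum>i<n. f i x" and ?g = "\<lambda>x. \<Sum>n. f n x"
  have ulim: "uniform_limit (ball 0 r) ?s ?g sequentially"
    by (rule Weierstrass_m_test[OF bound M])
  have sholo: "?s n holomorphic_on ball 0 r" for n
    by (intro holomorphic_intros holo)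
  \<comment> \<open>On the closed ball of half the radius the partial sums are also continuous up to
    the boundary, as the theorem on uniform limits requires.\<close>
  have "?g holomorphic_on ball 0 (r / 2)"
  proof (rule holomorphic_uniform_limit)
    show "uniform_limit (cball 0 (r / 2)) ?s ?g sequentially"
      by (rule uniform_limit_on_subset[OF ulim]) (use \<open>r > 0\<close> in auto)
    have "?s n holomorphic_on cball 0 (r / 2)" for n
      by (rule holomorphic_on_subset[OF sholo]) (use \<open>r > 0\<close> in auto)
    then show "\<forall>\<^sub>F n in sequentially. continuous_on (cball 0 (r / 2)) (?s n) \<and> ?s n holomorphic_on ball 0 (r / 2)"
      using ball_subset_cball holomorphic_on_imp_continuous_on holomorphic_on_subset
      by (intro always_eventually) blast
  qed auto
  then have g: "?g has_fps_expansion fps_expansion ?g 0"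
    using \<open>r > 0\<close> by (intro has_fps_expansion_fps_expansion[of "ball 0 (r / 2)"]) auto
  have "fps_expansion ?g 0 = G"
  proof (rule fps_ext)
    fix N
    have "(\<lambda>n. (deriv ^^ N) (?s n) 0) \<longlonglongrightarrow> (deriv ^^ N) ?g 0"
      by (rule higher_deriv_complex_uniform_limit[OF ulim])
         (use sholo \<open>r > 0\<close> in \<open>auto intro: always_eventually\<close>)
    moreover have "(deriv ^^ N) (?s n) 0 = (\<Sum>i<n. fps_nth (F i) N) * fact N" for n
      using fps_nth_fps_expansion[OF has_fps_expansion_sum[of "{..<n}" f F, OF exp], of N]
      by (simp add: fps_sum_nth)
    ultimately have "(\<lambda>n. (\<Sum>i<n. fps_nth (F i) N) * fact N) \<longlonglongrightarrow> (deriv ^^ N) ?g 0"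
      by simp
    moreover have "(\<lambda>n. (\<Sum>i<n. fps_nth (F i) N) * fact N) \<longlonglongrightarrow> fps_nth G N * fact N"
      using coeffs[of N] unfolding sums_def by (intro tendsto_intros)
    ultimately have "(deriv ^^ N) ?g 0 = fps_nth G N * fact N"
      by (rule LIMSEQ_unique)
    then show "fps_nth (fps_expansion ?g 0) N = fps_nth G N"
      using fps_nth_fps_expansion[OF g, of N] by simp
  qed
  with g show ?thesis by simp
qed

section \<open>Convergence and expansion of the hypergeometric side\<close>

lemma rhs_coeff_le: "rhs_coeff n \<le> 108 ^ n"
proof (induction n)
  case 0
  then show ?case by (simp add: rhs_coeff_def)
next
  case (Suc n)
  have "Suc n ^ 3 * rhs_coeff (Suc n) = 6 * Suc (2 * n) * Suc (3 * n) * Suc (Suc (3 * n)) * rhs_coeff n"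
    by (rule rhs_coeff_Suc)
  also have "\<dots> \<le> (108 * Suc n ^ 3) * 108 ^ n"
  proof (rule mult_le_mono[OF _ Suc])
    \<comment> \<open>The constant 108 is \<open>6 * 2 * 3 * 3\<close>, the limit of the coefficient
      ratio.\<close>
    show "6 * Suc (2 * n) * Suc (3 * n) * Suc (Suc (3 * n)) \<le> 108 * Suc n ^ 3"
      by (simp add: power3_eq_cube algebra_simps)
  qed
  finally show ?case
    by simp
qed

lemma norm_linear_le:
  fixes A B :: complex
  shows "norm (A * of_nat n + B) \<le> (norm A + norm B) * of_nat (Suc n)"
proof -
  have "norm (A * of_nat n + B) \<le> norm A * real n + norm B"
    using norm_triangle_ineq[of "A * of_nat n" B] by (simp add: norm_mult)
  also have "\<dots> \<le> norm A * real (Suc n) + norm B * real (Suc n)"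
    by (intro add_mono mult_left_mono) (auto simp: mult_le_cancel_left1)
  finally show ?thesis by (simp add: algebra_simps)
qed

lemma norm_linear_rhs_coeff_le:
  fixes A B y :: complex
  assumes "norm y \<le> r"
  shows "norm ((A * of_nat n + B) * of_nat (rhs_coeff n) * y ^ n) \<le>
    (norm A + norm B) * (of_nat (Suc n) * (108 * r) ^ n)"
proof -
  have "real (rhs_coeff n) \<le> 108 ^ n"
    using rhs_coeff_le[of n] by (metis of_nat_le_iff of_nat_numeral of_nat_power)
  then have "norm ((A * of_nat n + B) * of_nat (rhs_coeff n) * y ^ n) \<le>
     ((norm A + norm B) * of_nat (Suc n)) * 108 ^ n * r ^ n"
    unfolding norm_mult norm_power
    by (intro mult_mono norm_linear_le power_mono assms) (auto simp: assms)
  then show ?thesis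
    by (simp add: power_mult_distrib mult_ac)
qed

lemma summable_Suc_geometric: "\<bar>q\<bar> < 1 \<Longrightarrow> summable (\<lambda>n. c * (of_nat (Suc n) * q ^ n :: real))"
  by (intro summable_mult sums_summable[OF geometric_deriv_sums]) auto

lemma summable_linear_rhs_coeff:
  fixes A B y :: complex
  assumes "norm y < 1 / 108"
  shows "summable (\<lambda>n. (A * of_nat n + B) * of_nat (rhs_coeff n) * y ^ n)"
  using assms
  by (intro summable_comparison_test'[OF summable_Suc_geometric norm_linear_rhs_coeff_le[OF order.refl]]) auto

lemma rhs_term_eq:
  "rhs_term a b x n =
   (A_coeff a x * of_nat n + B_coeff a b x) * of_nat (rhs_coeff n) * (x\<^sup>2 * (1 - 4 * x)) ^ n"
  by (simp add: rhs_term_def rhs_coeff_def power_mult_distrib mult_ac flip: power_mult)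

text \<open>A crude bound below \<open>1 / 108\<close>; since \<open>108 / 200 < 1\<close>, the ball
  of radius \<open>1 / 100\<close> admits a geometric majorant.\<close>

lemma norm_cubic_le:
  fixes x :: complex
  assumes "norm x < 1 / 100"
  shows "norm (x\<^sup>2 * (1 - 4 * x)) \<le> 1 / 200"
proof -
  have "norm (1 - 4 * x) \<le> 2"
    using norm_triangle_ineq4[of 1 "4 * x"] assms by (simp add: norm_mult)
  moreover have "(norm x)\<^sup>2 \<le> (1 / 100)\<^sup>2"
    using assms by (intro power_mono) auto
  ultimately have "(norm x)\<^sup>2 * norm (1 - 4 * x) \<le> (1 / 100)\<^sup>2 * 2"
    by (intro mult_mono) auto
  then show ?thesis by (simp add: norm_mult norm_power power2_eq_square)
qed

lemma linear_rhs_coeff_has_fps_expansion: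
  "(\<lambda>x. \<Sum>n. (c * of_nat n + d) * of_nat (rhs_coeff n) * (x\<^sup>2 * (1 - 4 * x)) ^ n)
     has_fps_expansion rhs_sum (\<lambda>n. fps_const c * of_nat n + fps_const d)"
proof (rule has_fps_expansion_suminf[where r = "1 / 100"])
  show "(\<lambda>x. (c * of_nat n + d) * of_nat (rhs_coeff n) * (x\<^sup>2 * (1 - 4 * x)) ^ n)
      holomorphic_on ball 0 (1 / 100)" for n
    by (intro holomorphic_intros)
  show "(\<lambda>x. (c * of_nat n + d) * of_nat (rhs_coeff n) * (x\<^sup>2 * (1 - 4 * x)) ^ n) has_fps_expansion
      (fps_const c * of_nat n + fps_const d) * rhs_summand n" for n
    unfolding rhs_summand_def cubic_arg_def mult.assoc fps_of_nat[symmetric]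
    by (intro fps_expansion_intros)
  show "(\<lambda>n. fps_nth ((fps_const c * of_nat n + fps_const d) * rhs_summand n) N) sums
      fps_nth (rhs_sum (\<lambda>n. fps_const c * of_nat n + fps_const d)) N" for N
  proof -
    have "fps_nth (P * rhs_summand n) N = 0" if "n \<notin> {..N}" for n P
      by (rule fps_mult_nth_below[of n]) (use that in \<open>auto simp: rhs_summand_nth_eq_0\<close>)
    then show ?thesis unfolding rhs_sum_nth by (intro sums_finite) auto
  qed
  show "norm ((c * of_nat n + d) * of_nat (rhs_coeff n) * (x\<^sup>2 * (1 - 4 * x)) ^ n) \<le>
      (norm c + norm d) * (of_nat (Suc n) * (108 * (1 / 200)) ^ n)" if "x \<in> ball 0 (1 / 100)" for x n
    using that by (intro norm_linear_rhs_coeff_le norm_cubic_le) auto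
  show "summable (\<lambda>n. (norm c + norm d) * (of_nat (Suc n) * (108 * (1 / 200)) ^ n))"
    by (rule summable_Suc_geometric) auto
qed auto

section \<open>Convergence and expansion of the double series\<close>

definition lhs_summand_fun :: "nat \<Rightarrow> nat \<Rightarrow> complex \<Rightarrow> complex" where
  "lhs_summand_fun k m x = of_nat (lhs_coeff k m) * (x ^ (2 * k + m) * inverse (1 + 4 * x) ^ (2 * (k + m)))"

lemma lhs_summand_fun_has_fps_expansion: "lhs_summand_fun k m has_fps_expansion lhs_summand k m"
  unfolding lhs_summand_fun_def lhs_summand_def inv_one_plus_4X_def fps_of_nat[symmetric]
  by (intro fps_expansion_intros) simp

lemma lhs_term_eq: "lhs_term a b x n = (\<Sum>k\<le>n. (a * of_nat n + b) * lhs_summand_fun k (n - k) x)"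
proof -
  have "(a * of_nat n + b) * of_nat ((2 * n) choose n) * (x ^ n / (1 + 4 * x) ^ (2 * n)) *
     (of_nat ((2 * k) choose k) ^ 2 * of_nat ((2 * n - 2 * k) choose (n - k)) * x ^ k) =
     (a * of_nat n + b) * lhs_summand_fun k (n - k) x" if "k \<le> n" for k
  proof -
    have "x ^ (2 * k + (n - k)) = x ^ n * x ^ k"
      using that by (simp add: mult_2 add.commute flip: power_add)
    then show ?thesis
      using that
      by (simp add: lhs_summand_fun_def lhs_coeff_def divide_inverse power_inverse mult_ac diff_mult_distrib)
  qed
  then show ?thesis
    unfolding lhs_term_def sum_distrib_left atLeast0AtMost by (intro sum.cong) auto
qed

lemma central_binomial_le: "(2 * n) choose n \<le> 4 ^ n"
  using binomial_le_pow2[of "2 * n" n] by (simp add: power_mult)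

lemma lhs_coeff_le: "lhs_coeff k m \<le> 16 ^ (k + m) * 4 ^ k"
proof -
  have "lhs_coeff k m \<le> 4 ^ (k + m) * (4 ^ k) ^ 2 * 4 ^ m"
    unfolding lhs_coeff_def by (intro mult_mono power_mono central_binomial_le) auto
  also have "\<dots> = (4 * 4) ^ (k + m) * 4 ^ k"
    unfolding power_mult_distrib power_add by (simp add: power2_eq_square mult_ac)
  finally show ?thesis by simp
qed

lemma norm_lhs_summand_fun_le:
  assumes "norm x < 1 / 100"
  shows "norm (lhs_summand_fun k m x) \<le> (1 / 5) ^ (k + m)"
proof -
  have "real (lhs_coeff k m) \<le> 16 ^ (k + m) * 4 ^ k"
    using lhs_coeff_le[of k m, THEN of_nat_mono[where 'a = real]] by simp
  moreover have "norm x ^ (2 * k + m) \<le> (1 / 100) ^ (2 * k + m)"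
    using assms by (intro power_mono) auto
  moreover have "norm (inverse (1 + 4 * x)) ^ (2 * (k + m)) \<le> (25 / 24) ^ (2 * (k + m))"
  proof (intro power_mono)
    have "24 / 25 \<le> norm (1 + 4 * x)"
      using norm_diff_ineq[of 1 "4 * x"] assms by (simp add: norm_mult)
    then have "inverse (norm (1 + 4 * x)) \<le> inverse (24 / 25)"
      by (intro le_imp_inverse_le) auto
    then show "norm (inverse (1 + 4 * x)) \<le> 25 / 24" by (simp add: norm_inverse)
  qed auto
  ultimately have "norm (lhs_summand_fun k m x) \<le>
     (16 ^ (k + m) * 4 ^ k) * ((1 / 100) ^ (2 * k + m) * (25 / 24) ^ (2 * (k + m)))"
    unfolding lhs_summand_fun_def norm_mult norm_power norm_of_nat by (intro mult_mono) auto
  \<comment> \<open>Regrouped by exponent: the first base is about 0.174, hence below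
    \<open>1 / 5\<close>, and the second is 0.04, hence at most 1.\<close>
  also have "\<dots> = (16 * (1 / 100) * (25 / 24)\<^sup>2) ^ (k + m) * (4 * (1 / 100)) ^ k"
  proof -
    have "(1 / 100 :: real) ^ (2 * k + m) = (1 / 100) ^ (k + m) * (1 / 100) ^ k"
      unfolding power_add[symmetric] by (simp add: mult_2 add_ac)
    then show ?thesis
      unfolding power_mult[of "25 / 24" 2] power_mult_distrib by (simp only: mult_ac)
  qed
  also have "\<dots> \<le> (1 / 5) ^ (k + m) * 1"
    by (rule mult_mono[OF power_mono power_le_one]) (simp_all add: power2_eq_square)
  finally show ?thesis by simp
qed

lemma norm_lhs_term_le:
  assumes "norm x < 1 / 100"
  shows "norm (lhs_term a b x n) \<le> (norm a + norm b) * (of_nat (Suc n) * (2 / 5) ^ n)"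
proof -
  have "norm (lhs_term a b x n) \<le> (\<Sum>k\<le>n. (norm a + norm b) * of_nat (Suc n) * (1 / 5) ^ n)"
    unfolding lhs_term_eq
  proof (rule sum_norm_le)
    fix k assume "k \<in> {..n}"
    then show "norm ((a * of_nat n + b) * lhs_summand_fun k (n - k) x) \<le> (norm a + norm b) * of_nat (Suc n) * (1 / 5) ^ n"
      unfolding norm_mult using norm_lhs_summand_fun_le[OF assms, of k "n - k"] norm_linear_le[of a n b]
      by (intro mult_mono) auto
  qed
  also have "\<dots> = (norm a + norm b) * (of_nat (Suc n) * (real (Suc n) * (1 / 5) ^ n))"
    by simp
  \<comment> \<open>One factor \<open>Suc n\<close> comes from the linear weight, the other from the
    number of terms. The latter is absorbed into \<open>2 ^ n\<close>, turning \<open>1 / 5\<close>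
    into \<open>2 / 5\<close>.\<close>
  also have "\<dots> \<le> (norm a + norm b) * (of_nat (Suc n) * (2 ^ n * (1 / 5) ^ n))"
  proof (intro mult_left_mono mult_right_mono)
    have "Suc n \<le> 2 ^ n" by (simp add: Suc_leI)
    then show "real (Suc n) \<le> 2 ^ n" by (metis of_nat_le_iff of_nat_numeral of_nat_power)
  qed auto
  also have "\<dots> = (norm a + norm b) * (of_nat (Suc n) * (2 / 5) ^ n)"
    unfolding power_mult_distrib[symmetric] by simp
  finally show ?thesis .
qed

lemma lhs_has_fps_expansion:
  "(\<lambda>x. \<Sum>n. lhs_term a b x n) has_fps_expansion
     lhs_sum (\<lambda>k m. fps_const a * (of_nat k + of_nat m) + fps_const b)"
proof (rule has_fps_expansion_suminf[where r = "1 / 100"])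
  let ?P = "\<lambda>k m. fps_const a * (of_nat k + of_nat m) + fps_const b :: complex fps"
  show "(\<lambda>x. lhs_term a b x n) holomorphic_on ball 0 (1 / 100)" for n
  proof -
    have "1 + 4 * x \<noteq> 0" if "x \<in> ball 0 (1 / 100)" for x :: complex
    proof
      assume "1 + 4 * x = 0"
      then have "norm (4 * x) = norm (- 1 :: complex)" by (metis add_eq_0_iff)
      with that show False by (simp add: norm_mult)
    qed
    then show ?thesis
      unfolding lhs_term_eq lhs_summand_fun_def by (intro holomorphic_intros) auto
  qed
  show "norm (lhs_term a b x n) \<le> (norm a + norm b) * (of_nat (Suc n) * (2 / 5) ^ n)"
    if "x \<in> ball 0 (1 / 100)" for x n
    using that by (intro norm_lhs_term_le) auto
  show "summable (\<lambda>n. (norm a + norm b) * (of_nat (Suc n) * (2 / 5) ^ n))"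
    by (rule summable_Suc_geometric) auto
  show "(\<lambda>x. lhs_term a b x n) has_fps_expansion (\<Sum>k\<le>n. ?P k (n - k) * lhs_summand k (n - k))" for n
  proof -
    \<comment> \<open>On the diagonal \<open>k + m = n\<close> the weight is constant.\<close>
    have "?P k (n - k) = fps_const (a * of_nat n + b)" if "k \<le> n" for k
      using that by (simp add: algebra_simps of_nat_diff flip: fps_of_nat)
    then have "(\<Sum>k\<le>n. ?P k (n - k) * lhs_summand k (n - k)) = (\<Sum>k\<le>n. fps_const (a * of_nat n + b) * lhs_summand k (n - k))"
      by (intro sum.cong) auto
    then show ?thesis
      unfolding lhs_term_eq by (auto intro!: fps_expansion_intros lhs_summand_fun_has_fps_expansion)
  qed
  show "(\<lambda>n. fps_nth (\<Sum>k\<le>n. ?P k (n - k) * lhs_summand k (n - k)) N) sums fps_nth (lhs_sum ?P) N" for N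
  proof -
    have "fps_nth (\<Sum>k\<le>n. ?P k (n - k) * lhs_summand k (n - k)) N = 0" if "n \<notin> {..N}" for n
      unfolding fps_sum_nth
      by (intro sum.neutral ballI fps_mult_nth_below[of n]) (use that in \<open>auto simp: lhs_summand_nth_eq_0\<close>)
    \<comment> \<open>The triangle \<open>k + m \<le> N\<close> is summed along its diagonals
      \<open>k + m = n\<close>.\<close>
    moreover have "fps_nth (lhs_sum ?P) N = (\<Sum>n\<le>N. fps_nth (\<Sum>k\<le>n. ?P k (n - k) * lhs_summand k (n - k)) N)"
      unfolding lhs_sum_nth sum.triangle_reindex_eq fps_sum_nth ..
    ultimately show ?thesis
      using sums_finite[of "{..N}" "\<lambda>n. fps_nth (\<Sum>k\<le>n. ?P k (n - k) * lhs_summand k (n - k)) N"] by simp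
  qed
qed auto

lemma rhs_has_fps_expansion:
  "(\<lambda>x. \<Sum>n. rhs_term a b x n) has_fps_expansion
   4 * fps_const a * (1 + 4 * fps_X)\<^sup>2 * (1 - 6 * fps_X) * (fps_const (1/3) * inv_one_minus_4X\<^sup>2) * rhs_sum of_nat
   + (1 + 4 * fps_X) * (4 * fps_const a * fps_X * inv_one_minus_4X + fps_const b) * rhs_sum (\<lambda>n. 1)"
proof -
  \<comment> \<open>\<open>A_coeff\<close> and \<open>B_coeff\<close> depend on \<open>x\<close>, so
    the series is split into two with constant coefficients, \<open>?h 1 0\<close> and
    \<open>?h 0 1\<close>, and the rational prefactors are expanded separately.\<close>
  let ?h = "\<lambda>c d x. \<Sum>n. (c * of_nat n + d) * of_nat (rhs_coeff n) * (x\<^sup>2 * (1 - 4 * x)) ^ n :: complex"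
  have h: "?h 1 0 has_fps_expansion rhs_sum of_nat" "?h 0 1 has_fps_expansion rhs_sum (\<lambda>n. 1)"
    using linear_rhs_coeff_has_fps_expansion[of 1 0] linear_rhs_coeff_has_fps_expansion[of 0 1] by simp_all
  have e: "(\<lambda>x. 4 * a * (1 + 4 * x)\<^sup>2 * (1 - 6 * x) * ((1/3) * (inverse (1 - 4 * x))\<^sup>2) * ?h 1 0 x
      + (1 + 4 * x) * (4 * a * x * inverse (1 - 4 * x) + b) * ?h 0 1 x) has_fps_expansion
   4 * fps_const a * (1 + 4 * fps_X)\<^sup>2 * (1 - 6 * fps_X) * (fps_const (1/3) * inv_one_minus_4X\<^sup>2) * rhs_sum of_nat
   + (1 + 4 * fps_X) * (4 * fps_const a * fps_X * inv_one_minus_4X + fps_const b) * rhs_sum (\<lambda>n. 1)"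
    unfolding inv_one_minus_4X_def by (intro fps_expansion_intros h) auto
  have ev: "\<forall>\<^sub>F x in nhds 0. 4 * a * (1 + 4 * x)\<^sup>2 * (1 - 6 * x) * ((1/3) * (inverse (1 - 4 * x))\<^sup>2) * ?h 1 0 x
      + (1 + 4 * x) * (4 * a * x * inverse (1 - 4 * x) + b) * ?h 0 1 x = (\<Sum>n. rhs_term a b x n)"
  proof -
    have "\<forall>\<^sub>F x in nhds 0. x \<in> ball 0 (1 / 100 :: real)"
      by (intro eventually_nhds_in_open) auto
    then show ?thesis
    proof eventually_elim
      case (elim x)
      then have "norm (x\<^sup>2 * (1 - 4 * x)) < 1 / 108"
        using norm_cubic_le[of x] by simp
      note s = summable_linear_rhs_coeff[OF this]
      have "(\<Sum>n. rhs_term a b x n) = A_coeff a x * ?h 1 0 x + B_coeff a b x * ?h 0 1 x"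
        unfolding suminf_mult[OF s, symmetric] suminf_add[OF summable_mult[OF s] summable_mult[OF s]] rhs_term_eq
        by (simp add: algebra_simps)
      then show ?case
        by (simp add: A_coeff_def B_coeff_def field_simps)
    qed
  qed
  show ?thesis
    by (rule iffD1[OF has_fps_expansion_cong[OF ev refl] e])
qed

theorem theorem6p5:
  fixes a b :: complex
  shows "(\<forall>\<^sub>F x in nhds 0.
            summable (lhs_term a b x) \<and> summable (rhs_term a b x) \<and>
            (\<Sum>n. lhs_term a b x n) = (\<Sum>n. rhs_term a b x n)) \<and>
         (\<forall>x::real. - 1 / 12 < x \<and> x < 1 / 6 \<longrightarrow> summable (rhs_term a b (complex_of_real x)))"
proof (intro conjI allI impI)
  have "\<forall>\<^sub>F x in nhds 0. x \<in> ball (0 :: complex) (1 / 100)"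
    by (intro eventually_nhds_in_open) auto
  \<comment> \<open>By \<open>lhs_sum_linear_eq\<close> both functions have the same formal
    expansion, and near 0 each equals the evaluation of that expansion.\<close>
  moreover have "\<forall>\<^sub>F x in nhds 0. (\<Sum>n. lhs_term a b x n) = (\<Sum>n. rhs_term a b x n)"
    using lhs_has_fps_expansion[of a b] rhs_has_fps_expansion[of a b]
    unfolding lhs_sum_linear_eq has_fps_expansion_def by (auto elim: eventually_elim2)
  ultimately show "\<forall>\<^sub>F x in nhds 0. summable (lhs_term a b x) \<and> summable (rhs_term a b x) \<and>
      (\<Sum>n. lhs_term a b x n) = (\<Sum>n. rhs_term a b x n)"
  proof eventually_elim
    case (elim x)
    then have x: "norm x < 1 / 100" by simp
    have "summable (lhs_term a b x)"
      by (rule summable_comparison_test'[OF summable_Suc_geometric norm_lhs_term_le[OF x]]) auto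
    moreover have "summable (rhs_term a b x)"
      unfolding rhs_term_eq by (rule summable_linear_rhs_coeff) (use norm_cubic_le[OF x] in simp)
    ultimately show ?case using elim by blast
  qed
next
  fix x :: real
  assume x: "- 1 / 12 < x \<and> x < 1 / 6"
  \<comment> \<open>The factorisation explains the interval: \<open>- 1 / 12\<close> is a simple
    root and \<open>1 / 6\<close> a double root of the difference between the radius
    \<open>1 / 108\<close> and the argument.\<close>
  have "1 / 108 - x\<^sup>2 * (1 - 4 * x) = (1 / 6 - x)\<^sup>2 * (4 * x + 1 / 3)"
    by (simp add: power2_eq_square field_simps)
  also have "\<dots> > 0" using x by simp
  finally have "x\<^sup>2 * (1 - 4 * x) < 1 / 108" by simp
  \<comment> \<open>Here \<open>x < 1 / 6\<close> gives \<open>4 * x < 1\<close>, so the norm is the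
    value itself.\<close>
  moreover have "0 \<le> x\<^sup>2 * (1 - 4 * x)" using x by simp
  ultimately have "norm (complex_of_real (x\<^sup>2 * (1 - 4 * x))) < 1 / 108"
    unfolding norm_of_real by simp
  then have "norm ((complex_of_real x)\<^sup>2 * (1 - 4 * complex_of_real x)) < 1 / 108"
    by (simp only: of_real_mult of_real_power of_real_diff of_real_1 of_real_numeral)
  then show "summable (rhs_term a b (complex_of_real x))"
    unfolding rhs_term_eq by (rule summable_linear_rhs_coeff)
qed

end
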